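(* For each $t\in\{3,4,5\}$ and every integer $r\geq \binom{t}{2}$, the complete graph $K_t$ is $r$-rainbow-uncommon.
   Context: All graphs are simple. A copy of a graph $H$ in a graph $G$ is a subgraph of $G$ isomorphic to $H$. An $r$-coloring of a set $X$ is a surjective function $c:X\to\{1,\dots,r\}$. Under an edge-coloring of $G$, a subgraph $H$ is rainbow if all edges of $H$ receive pairwise distinct colors. For a graph $H$ with $e$ edges, let $M_{\mathrm{rb}}(H;n,r)$ be the maximum, over all $r$-colorings of $E(K_n)$, of the number of rainbow copies of $H$ in $K_n$; let $m_{\mathrm{rb}}(H;n,r)=M_{\mathrm{rb}}(H;n,r)/(\text{number of copies of } H \text{ in } K_n)$ and $m_{\mathrm{rb}}(H;r)=\lim_{n\to\infty} m_{\mathrm{rb}}(H;n,r)$ (this limit exists). $H$ is called $r$-rainbow-common if $m_{\mathrm{rb}}(H;r)=\binom{r}{e}e!/r^e$ (the probability that a fixed copy of $H$ is rainbow under a uniformly random coloring with $r$ colors), and $r$-rainbow-uncommon otherwise. *)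

theory Defs
  imports Complex_Main
begin

type_synonym 'a sgraph = "'a set \<times> 'a set set"

abbreviation verts :: "'a sgraph \<Rightarrow> 'a set" where
  "verts G \<equiv> fst G"

abbreviation edges :: "'a sgraph \<Rightarrow> 'a set set" where
  "edges G \<equiv> snd G"

definition simple_graph :: "'a sgraph \<Rightarrow> bool" where
  "simple_graph G \<longleftrightarrow> (\<forall>e\<in>edges G. e \<subseteq> verts G \<and> card e = 2)"

definition complete_graph :: "nat \<Rightarrow> nat sgraph" where
  "complete_graph n = ({1..n}, {e. e \<subseteq> {1..n} \<and> card e = 2})"

definition subgraph_of :: "'a sgraph \<Rightarrow> 'a sgraph \<Rightarrow> bool" where
  "subgraph_of S G \<longleftrightarrow> simple_graph S \<and> verts S \<subseteq> verts G \<and> edges S \<subseteq> edges G"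

definition isomorphic_graphs :: "'a sgraph \<Rightarrow> 'b sgraph \<Rightarrow> bool" where
  "isomorphic_graphs G H \<longleftrightarrow>
     (\<exists>f. bij_betw f (verts G) (verts H) \<and>
          (\<forall>u\<in>verts G. \<forall>v\<in>verts G. {u, v} \<in> edges G \<longleftrightarrow> {f u, f v} \<in> edges H))"

definition copies :: "'a sgraph \<Rightarrow> 'b sgraph \<Rightarrow> 'b sgraph set" where
  "copies H G = {S. subgraph_of S G \<and> isomorphic_graphs S H}"

text \<open>Colorings are total functions; only their values on the colored set matter.\<close>

definition r_coloring :: "nat \<Rightarrow> 'a set \<Rightarrow> ('a \<Rightarrow> nat) \<Rightarrow> bool" where
  "r_coloring r X c \<longleftrightarrow> c ` X = {1..r}"

definition rainbow :: "('a set \<Rightarrow> nat) \<Rightarrow> 'a sgraph \<Rightarrow> bool" where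
  "rainbow c S \<longleftrightarrow> inj_on c (edges S)"

text \<open>If \<open>n choose 2 < r\<close>, there is no \<open>r\<close>-coloring of the edges of \<open>K\<^sub>n\<close> and the
  maximum below is over the empty set, hence unspecified. This affects only finitely many \<open>n\<close>,
  and so not the limit.\<close>

definition max_rainbow_copies :: "'a sgraph \<Rightarrow> nat \<Rightarrow> nat \<Rightarrow> nat" where
  "max_rainbow_copies H n r =
     Max {card {S \<in> copies H (complete_graph n). rainbow c S} | c.
            r_coloring r (edges (complete_graph n)) c}"

definition max_rainbow_density :: "'a sgraph \<Rightarrow> nat \<Rightarrow> nat \<Rightarrow> real" where
  "max_rainbow_density H n r =
     real (max_rainbow_copies H n r) / real (card (copies H (complete_graph n)))"

definition limit_rainbow_density :: "'a sgraph \<Rightarrow> nat \<Rightarrow> real" where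
  "limit_rainbow_density H r = lim (\<lambda>n. max_rainbow_density H n r)"

definition rainbow_common :: "nat \<Rightarrow> 'a sgraph \<Rightarrow> bool" where
  "rainbow_common r H \<longleftrightarrow>
     limit_rainbow_density H r =
       real (r choose card (edges H)) * fact (card (edges H)) / real r ^ card (edges H)"

definition rainbow_uncommon :: "nat \<Rightarrow> 'a sgraph \<Rightarrow> bool" where
  "rainbow_uncommon r H \<longleftrightarrow> \<not> rainbow_common r H"

end

theory Submission
  imports Defs "HOL-Library.FuncSet"
begin

text \<open>Recoloring a repeated edge color with a missing color never destroys a rainbow copy, so
  surjectivity may be dropped; the maximal density then decreases in \<open>n\<close> (delete a random vertex),
  and the limit exists and is bounded below by the expected rainbow density of any random coloring.

  Give the vertices independent fair signs \<open>s\<close>, and give each edge \<open>uv\<close> color \<open>k\<close> with probability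
  \<open>1 / r + \<epsilon> * a k * s u * s v\<close>, where \<open>a = (2, -1, -1, 0, 0, \<dots>)\<close>. Expanding the probability that a copy
  is rainbow over sets \<open>G\<close> of its edges, only those \<open>G\<close> with all degrees even survive the average over
  the signs. So the terms with \<open>card G \<in> {1, 2}\<close> vanish, the triangles contribute a positive
  multiple of \<open>\<epsilon> ^ 3\<close> because \<open>2 * (-1) * (-1) > 0\<close>, and everything else is of order \<open>\<epsilon> ^ 4\<close>. Hence a
  small \<open>\<epsilon>\<close> beats the uniform coloring, for every \<open>t \<ge> 3\<close>.\<close>

section \<open>Reduction to vertex sets\<close>

definition pairs :: "'a set \<Rightarrow> 'a set set" where
  "pairs V = {e. e \<subseteq> V \<and> card e = 2}"

definition rainbow_sets :: "nat \<Rightarrow> 'a set \<Rightarrow> ('a set \<Rightarrow> nat) \<Rightarrow> 'a set set" where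
  "rainbow_sets t V c = {S. S \<subseteq> V \<and> card S = t \<and> inj_on c (pairs S)}"

lemma finite_pairs [simp]: "finite V \<Longrightarrow> finite (pairs V)"
  by (simp add: pairs_def)

lemma card_pairs: "finite V \<Longrightarrow> card (pairs V) = card V choose 2"
  by (simp add: pairs_def n_subsets)

lemma pairs_mono: "S \<subseteq> V \<Longrightarrow> pairs S \<subseteq> pairs V"
  by (auto simp: pairs_def)

lemma finite_rainbow_sets [simp]: "finite V \<Longrightarrow> finite (rainbow_sets t V c)"
  by (simp add: rainbow_sets_def)

lemma edges_complete_graph: "edges (complete_graph n) = pairs {1..n}"
  by (simp add: complete_graph_def pairs_def)

text \<open>An isomorphism onto a complete graph forces every pair of vertices to be an edge, so a
  copy is determined by its vertex set, and counting copies becomes counting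
  \<open>t\<close>-subsets.\<close>

lemma copies_complete_graph:
  "copies (complete_graph t) (complete_graph n) = (\<lambda>S. (S, pairs S)) ` {S. S \<subseteq> {1..n} \<and> card S = t}"
proof (intro equalityI subsetI)
  fix G assume "G \<in> copies (complete_graph t) (complete_graph n)"
  then have sub: "subgraph_of G (complete_graph n)" and iso: "isomorphic_graphs G (complete_graph t)"
    by (auto simp: copies_def)
  obtain V E where G: "G = (V, E)" by (cases G)
  have V: "V \<subseteq> {1..n}" and E: "E \<subseteq> pairs V"
    using sub G by (auto simp: subgraph_of_def complete_graph_def simple_graph_def pairs_def)
  obtain f where f: "bij_betw f V {1..t}"
    and adj: "\<And>u v. u \<in> V \<Longrightarrow> v \<in> V \<Longrightarrow> {u, v} \<in> E \<longleftrightarrow> {f u, f v} \<subseteq> {1..t} \<and> card {f u, f v} = 2"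
    using iso G by (auto simp: isomorphic_graphs_def complete_graph_def)
  have "card V = t"
    using bij_betw_same_card[OF f] by simp
  moreover have "pairs V \<subseteq> E"
  proof
    fix e assume "e \<in> pairs V"
    then obtain u v where e: "e = {u, v}" "u \<noteq> v" "u \<in> V" "v \<in> V"
      by (auto simp: pairs_def card_2_iff)
    then have "f u \<noteq> f v" "f u \<in> {1..t}" "f v \<in> {1..t}"
      using inj_onD[OF bij_betw_imp_inj_on[OF f], of u v] bij_betw_apply[OF f] by blast+
    then show "e \<in> E"
      using adj[of u v] e by auto
  qed
  ultimately show "G \<in> (\<lambda>S. (S, pairs S)) ` {S. S \<subseteq> {1..n} \<and> card S = t}"
    using E V G by auto
next
  fix G assume "G \<in> (\<lambda>S. (S, pairs S)) ` {S. S \<subseteq> {1..n} \<and> card S = t}"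
  then obtain S where G: "G = (S, pairs S)" and S: "S \<subseteq> {1..n}" "card S = t" by auto
  have "finite S" using S finite_subset by blast
  then obtain f where f: "bij_betw f S {1..t}"
    using finite_same_card_bij[of S "{1..t}"] S by auto
  have "isomorphic_graphs G (complete_graph t)"
    unfolding isomorphic_graphs_def
  proof (intro exI conjI ballI)
    show "bij_betw f (verts G) (verts (complete_graph t))"
      using f G by (simp add: complete_graph_def)
    fix u v assume uv: "u \<in> verts G" "v \<in> verts G"
    then have "f u = f v \<longleftrightarrow> u = v" "f u \<in> {1..t}" "f v \<in> {1..t}"
      using f G by (auto simp: bij_betw_def inj_on_def)
    then show "{u, v} \<in> edges G \<longleftrightarrow> {f u, f v} \<in> edges (complete_graph t)"
      using G uv by (auto simp: complete_graph_def pairs_def card_2_iff doubleton_eq_iff)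
  qed
  moreover have "subgraph_of G (complete_graph n)"
    using S G by (auto simp: subgraph_of_def complete_graph_def simple_graph_def pairs_def)
  ultimately show "G \<in> copies (complete_graph t) (complete_graph n)"
    by (simp add: copies_def)
qed

lemma card_copies_complete_graph: "card (copies (complete_graph t) (complete_graph n)) = n choose t"
proof -
  have "inj_on (\<lambda>S. (S, pairs S)) {S. S \<subseteq> {1..n} \<and> card S = t}"
    by (auto simp: inj_on_def)
  then show ?thesis
    unfolding copies_complete_graph by (simp add: card_image n_subsets)
qed

lemma card_rainbow_copies_complete_graph:
  "card {S \<in> copies (complete_graph t) (complete_graph n). rainbow c S} = card (rainbow_sets t {1..n} c)"
proof -
  have "{S \<in> copies (complete_graph t) (complete_graph n). rainbow c S}
      = (\<lambda>S. (S, pairs S)) ` rainbow_sets t {1..n} c"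
    by (auto simp: copies_complete_graph rainbow_def rainbow_sets_def)
  moreover have "inj_on (\<lambda>S. (S, pairs S)) (rainbow_sets t {1..n} c)"
    by (auto simp: inj_on_def)
  ultimately show ?thesis by (simp add: card_image)
qed

section \<open>Existence of the limit\<close>

text \<open>Colorings need not be surjective here; \<open>max_rainbow_copies_complete_graph\<close> shows that this
  does not change the maximum, and monotonicity in \<open>n\<close> becomes provable by deleting a vertex.\<close>

definition max_rainbow_sets :: "nat \<Rightarrow> nat \<Rightarrow> nat \<Rightarrow> nat" where
  "max_rainbow_sets t r n =
     Max {card (rainbow_sets t {1..n} c) | c. c ` pairs {1..n} \<subseteq> {1..r}}"

lemma finite_rainbow_counts: "finite {card (rainbow_sets t {1..n::nat} c) | c. P c}"
proof (rule finite_subset)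
  show "{card (rainbow_sets t {1..n::nat} c) | c. P c} \<subseteq> {..card (Pow {1..n})}"
    by (auto simp del: card_Pow intro!: card_mono simp: rainbow_sets_def)
qed simp

text \<open>The coloring is transported along a bijection with \<open>{1..n}\<close>. This lets the
  maximum, defined only on initial segments, be applied after an arbitrary vertex has been
  deleted.\<close>

lemma card_rainbow_sets_le_max:
  fixes V :: "'a set"
  assumes V: "finite V" "card V = n" and c: "c ` pairs V \<subseteq> {1..r}"
  shows "card (rainbow_sets t V c) \<le> max_rainbow_sets t r n"
proof -
  obtain f where f: "bij_betw f V {1..n}"
    using finite_same_card_bij[of V "{1..n}"] V by auto
  define g where "g = inv_into V f"
  have g: "bij_betw g {1..n} V"
    unfolding g_def using f by (rule bij_betw_inv_into)
  have gf: "g ` f ` S = S" if "S \<subseteq> V" for S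
  proof -
    have "inj_on f V" using f by (simp add: bij_betw_def)
    then have "g (f x) = x" if "x \<in> S" for x
      using that \<open>S \<subseteq> V\<close> unfolding g_def by (auto simp: inv_into_f_f)
    then show ?thesis by (auto simp: image_image)
  qed
  define c' where "c' = (\<lambda>e. c (g ` e))"
  have gpairs: "g ` e \<in> pairs (g ` S)" if "e \<in> pairs S" "S \<subseteq> {1..n}" for e S
  proof -
    have "inj_on g e"
      using g that by (auto simp: bij_betw_def pairs_def intro: inj_on_subset)
    then show ?thesis
      using that by (auto simp: pairs_def card_image)
  qed
  have gV: "g ` {1..n} = V" using g by (simp add: bij_betw_def)
  have "c' ` pairs {1..n} \<subseteq> {1..r}"
    using c gpairs[of _ "{1..n}"] gV unfolding c'_def by fastforce
  then have le: "card (rainbow_sets t {1..n} c') \<le> max_rainbow_sets t r n"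
    unfolding max_rainbow_sets_def by (intro Max_ge finite_rainbow_counts) auto
  have "(`) f ` rainbow_sets t V c \<subseteq> rainbow_sets t {1..n} c'"
  proof
    fix T assume "T \<in> (`) f ` rainbow_sets t V c"
    then obtain S where T: "T = f ` S" and S: "S \<subseteq> V" "card S = t" "inj_on c (pairs S)"
      by (auto simp: rainbow_sets_def)
    have "card T = t" "T \<subseteq> {1..n}"
      using f S T by (auto simp: bij_betw_def card_image inj_on_subset)
    moreover have "inj_on c' (pairs T)"
    proof (rule inj_onI)
      fix e e' assume e: "e \<in> pairs T" "e' \<in> pairs T" and eq: "c' e = c' e'"
      have "g ` e \<in> pairs S" "g ` e' \<in> pairs S"
        using gpairs[OF e(1) \<open>T \<subseteq> {1..n}\<close>] gpairs[OF e(2) \<open>T \<subseteq> {1..n}\<close>] gf[OF S(1)] T by auto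
      then have "g ` e = g ` e'"
        using eq S(3) by (auto simp: c'_def inj_on_def)
      moreover have "inj_on g {1..n}" using g by (simp add: bij_betw_def)
      moreover have "e \<subseteq> {1..n}" "e' \<subseteq> {1..n}"
        using e \<open>T \<subseteq> {1..n}\<close> by (auto simp: pairs_def)
      ultimately show "e = e'" by (simp add: inj_on_image_eq_iff)
    qed
    ultimately show "T \<in> rainbow_sets t {1..n} c'"
      by (simp add: rainbow_sets_def)
  qed
  moreover have "inj_on ((`) f) (rainbow_sets t V c)"
    by (rule inj_on_inverseI[where g = "(`) g"]) (auto simp: rainbow_sets_def gf)
  ultimately have "card (rainbow_sets t V c) \<le> card (rainbow_sets t {1..n} c')"
    by (metis card_image card_mono finite_atLeastAtMost finite_rainbow_sets)
  with le show ?thesis by simp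
qed

lemma max_rainbow_sets_attained:
  assumes "r \<ge> 1"
  obtains c where "c ` pairs {1..n} \<subseteq> {1..r}" "max_rainbow_sets t r n = card (rainbow_sets t {1..n} c)"
proof -
  \<comment> \<open>The constant coloring keeps the maximum from being taken over an empty
    set.\<close>
  have "card (rainbow_sets t {1..n} (\<lambda>_. 1)) \<in> {card (rainbow_sets t {1..n} c) | c. c ` pairs {1..n} \<subseteq> {1..r}}"
    using assms by auto
  then have "max_rainbow_sets t r n \<in> {card (rainbow_sets t {1..n} c) | c. c ` pairs {1..n} \<subseteq> {1..r}}"
    unfolding max_rainbow_sets_def by (intro Max_in finite_rainbow_counts) auto
  then show ?thesis using that by auto
qed

text \<open>Each missing color is given to an edge whose color also occurs elsewhere.\<close>

lemma surjective_recoloring: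
  fixes c :: "'a \<Rightarrow> nat"
  assumes E: "finite E" "r \<le> card E" and c: "c ` E \<subseteq> {1..r}"
  obtains c' where "c' ` E = {1..r}" "\<And>F. F \<subseteq> E \<Longrightarrow> inj_on c F \<Longrightarrow> inj_on c' F"
proof -
  \<comment> \<open>\<open>T\<close> has one representative edge per color in use. Edges outside
    \<open>T\<close> can be recolored without losing a color, and \<open>r \<le> card E\<close>
    leaves enough of them for all missing colors \<open>K\<close>.\<close>
  obtain T where T: "T \<subseteq> E" "inj_on c T" "c ` E = c ` T"
    using subset_image_inj[of "c ` E" c E] by auto
  define K where "K = {1..r} - c ` E"
  have "card (c ` E) = card T" using T by (simp add: card_image)
  then have "card K = r - card T"
    unfolding K_def using c E(1) by (simp add: card_Diff_subset)
  moreover have "card (E - T) = card E - card T"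
    using T E by (simp add: card_Diff_subset finite_subset)
  ultimately have "card K \<le> card (E - T)" using E(2) by simp
  then obtain U where U: "U \<subseteq> E - T" "card U = card K" "finite U"
    by (rule obtain_subset_with_card_n)
  have "finite K" by (simp add: K_def)
  then obtain g where g: "bij_betw g U K"
    using finite_same_card_bij[of U K] U by auto
  define c' where "c' = (\<lambda>e. if e \<in> U then g e else c e)"
  have gU: "g ` U = K" "inj_on g U" using g by (auto simp: bij_betw_def)
  have "c' ` E = {1..r}"
  proof
    show "c' ` E \<subseteq> {1..r}" using c gU unfolding c'_def K_def by auto
    show "{1..r} \<subseteq> c' ` E"
    proof
      fix k assume k: "k \<in> {1..r}"
      show "k \<in> c' ` E"
      proof (cases "k \<in> c ` E")
        case True
        then obtain e where "e \<in> T" "k = c e" using T(3) by auto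
        then have "k = c' e" "e \<in> E" using U T by (auto simp: c'_def)
        then show ?thesis by blast
      next
        case False
        then have "k \<in> g ` U" using k gU by (simp add: K_def)
        then obtain e where "e \<in> U" "k = g e" by auto
        then have "k = c' e" "e \<in> E" using U by (auto simp: c'_def)
        then show ?thesis by blast
      qed
    qed
  qed
  moreover have "inj_on c' F" if F: "F \<subseteq> E" "inj_on c F" for F
  proof (rule inj_onI)
    fix e e' assume e: "e \<in> F" "e' \<in> F" "c' e = c' e'"
    \<comment> \<open>New colors lie outside the image of \<open>c\<close>, so they clash with no
      old color.\<close>
    have new: "g x \<noteq> c y" if "x \<in> U" "y \<in> F" for x y
    proof -
      have "g x \<in> K" "c y \<in> c ` E" using that F gU by auto
      then show ?thesis by (auto simp: K_def)
    qed
    show "e = e'"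
      using e new[of e e'] new[of e' e] gU(2) F(2)
      by (cases "e \<in> U"; cases "e' \<in> U") (auto simp: c'_def inj_on_def)
  qed
  ultimately show ?thesis using that by blast
qed

text \<open>An optimal coloring, possibly not surjective, is recolored to a surjective one that
  keeps all its rainbow sets. The bound on \<open>r\<close> guarantees enough edges for
  this.\<close>

lemma max_rainbow_copies_complete_graph:
  assumes "r \<ge> 1" "r \<le> n choose 2"
  shows "max_rainbow_copies (complete_graph t) n r = max_rainbow_sets t r n"
proof -
  obtain c where c: "c ` pairs {1..n} \<subseteq> {1..r}"
    and max: "max_rainbow_sets t r n = card (rainbow_sets t {1..n} c)"
    using max_rainbow_sets_attained[OF assms(1)] by blast
  have "r \<le> card (pairs {1..n})" using assms(2) by (simp add: card_pairs)
  then obtain c' where c': "c' ` pairs {1..n} = {1..r}"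
    and inj: "\<And>F. F \<subseteq> pairs {1..n} \<Longrightarrow> inj_on c F \<Longrightarrow> inj_on c' F"
    using surjective_recoloring[of "pairs {1..n}" r c] c by auto
  have "rainbow_sets t {1..n} c \<subseteq> rainbow_sets t {1..n} c'"
    by (auto simp: rainbow_sets_def intro!: inj pairs_mono)
  then have le: "max_rainbow_sets t r n \<le> card (rainbow_sets t {1..n} c')"
    unfolding max by (simp add: card_mono)
  have "max_rainbow_copies (complete_graph t) n r
      = Max {card (rainbow_sets t {1..n} c) | c. c ` pairs {1..n} = {1..r}}"
    by (simp add: max_rainbow_copies_def card_rainbow_copies_complete_graph r_coloring_def
        edges_complete_graph)
  also have "\<dots> = max_rainbow_sets t r n"
  proof (rule Max_eqI)
    fix y assume "y \<in> {card (rainbow_sets t {1..n} c) | c. c ` pairs {1..n} = {1..r}}"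
    then show "y \<le> max_rainbow_sets t r n"
      using card_rainbow_sets_le_max[of "{1..n}" n _ r t] by auto
  next
    have "max_rainbow_sets t r n = card (rainbow_sets t {1..n} c')"
      using le card_rainbow_sets_le_max[of "{1..n}" n c' r t] c' by simp
    then show "max_rainbow_sets t r n \<in> {card (rainbow_sets t {1..n} c) | c. c ` pairs {1..n} = {1..r}}"
      using c' by blast
  qed (rule finite_rainbow_counts)
  finally show ?thesis .
qed

text \<open>Double counting of the pairs of a rainbow set \<open>S\<close> and a vertex
  \<open>v\<close> outside it: each \<open>S\<close> misses \<open>Suc n - t\<close> vertices, and
  the sets avoiding a given \<open>v\<close> are the rainbow sets of a coloring on \<open>n\<close>
  vertices.\<close>

lemma max_rainbow_sets_Suc:
  assumes "r \<ge> 1"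
  shows "(Suc n - t) * max_rainbow_sets t r (Suc n) \<le> Suc n * max_rainbow_sets t r n"
proof -
  obtain c where c: "c ` pairs {1..Suc n} \<subseteq> {1..r}"
    and max: "max_rainbow_sets t r (Suc n) = card (rainbow_sets t {1..Suc n} c)"
    using max_rainbow_sets_attained[OF assms] by blast
  let ?V = "{1..Suc n}"
  let ?R = "rainbow_sets t ?V c"
  have "(\<Sum>S\<in>?R. card (?V - S)) = (\<Sum>S\<in>?R. Suc n - t)"
    by (intro sum.cong refl) (auto simp: rainbow_sets_def card_Diff_subset finite_subset)
  also have "\<dots> = (Suc n - t) * max_rainbow_sets t r (Suc n)"
    by (simp add: max)
  finally have "(Suc n - t) * max_rainbow_sets t r (Suc n) = (\<Sum>S\<in>?R. card (?V - S))" ..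
  also have "\<dots> = (\<Sum>S\<in>?R. \<Sum>v\<in>{v \<in> ?V. v \<notin> S}. 1)"
    by (intro sum.cong refl) (simp add: set_diff_eq)
  also have "\<dots> = (\<Sum>v\<in>?V. \<Sum>S\<in>{S \<in> ?R. v \<notin> S}. 1)"
    by (rule sum.swap_restrict) simp_all
  also have "\<dots> \<le> (\<Sum>v\<in>?V. max_rainbow_sets t r n)"
  proof (rule sum_mono)
    fix v assume v: "v \<in> ?V"
    have "{S \<in> ?R. v \<notin> S} = rainbow_sets t (?V - {v}) c"
      by (auto simp: rainbow_sets_def)
    moreover have card: "card (?V - {v}) = n" using v by simp
    moreover have "c ` pairs (?V - {v}) \<subseteq> {1..r}"
      using c pairs_mono[of "?V - {v}" ?V] by blast
    ultimately show "(\<Sum>S\<in>{S \<in> ?R. v \<notin> S}. 1) \<le> max_rainbow_sets t r n"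
      using card_rainbow_sets_le_max[of "?V - {v}" n c r t] card by simp
  qed
  finally show ?thesis by simp
qed

lemma max_rainbow_ratio_antimono:
  assumes "r \<ge> 1" "t \<le> n"
  shows "real (max_rainbow_sets t r (Suc n)) / real (Suc n choose t)
       \<le> real (max_rainbow_sets t r n) / real (n choose t)"
proof -
  let ?M = "max_rainbow_sets t r"
  \<comment> \<open>The same double count for all \<open>t\<close>-sets; dividing the two gives the
    comparison of densities.\<close>
  have absorb: "(Suc n - t) * (Suc n choose t) = Suc n * (n choose t)"
    using binomial_absorb_comp[of "Suc n" t] by simp
  have pos: "real (Suc n - t) > 0" "real (n choose t) > 0" "real (Suc n choose t) > 0"
    using assms by auto
  have "Suc n * (?M (Suc n) * (n choose t)) = ?M (Suc n) * ((Suc n - t) * (Suc n choose t))"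
    unfolding absorb by (simp only: ac_simps)
  also have "\<dots> = ((Suc n - t) * ?M (Suc n)) * (Suc n choose t)"
    by (simp only: ac_simps)
  also have "\<dots> \<le> (Suc n * ?M n) * (Suc n choose t)"
    using max_rainbow_sets_Suc[OF assms(1)] by (rule mult_le_mono1)
  also have "\<dots> = Suc n * (?M n * (Suc n choose t))"
    by (simp only: ac_simps)
  finally have "?M (Suc n) * (n choose t) \<le> ?M n * (Suc n choose t)"
    by (subst (asm) Suc_mult_le_cancel1)
  then have "real (?M (Suc n)) * real (n choose t) \<le> real (?M n) * real (Suc n choose t)"
    by (metis of_nat_le_iff of_nat_mult)
  then show ?thesis using pos by (simp add: field_simps del: binomial_Suc_Suc)
qed

text \<open>The value of \<open>lim\<close> is informative only once convergence is known; it comes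
  from the antitone, nonnegative ratios.\<close>

lemma limit_rainbow_density_ge:
  assumes r: "r \<ge> 1"
    and lb: "\<And>n. real (n choose t) * p \<le> real (max_rainbow_sets t r n)"
  shows "p \<le> limit_rainbow_density (complete_graph t) r"
proof -
  \<comment> \<open>From \<open>N\<close> on, \<open>t \<le> n\<close> makes
    \<open>n choose t\<close> positive, and \<open>r + 1 \<le> n\<close> gives
    \<open>r \<le> n choose 2\<close>, so that surjective colorings exist.\<close>
  define N where "N = max 2 (max t (r + 1))"
  define X where "X = (\<lambda>k. real (max_rainbow_sets t r (k + N)) / real ((k + N) choose t))"
  have "decseq X"
    unfolding decseq_Suc_iff X_def using max_rainbow_ratio_antimono[OF r, of t "k + N" for k]
    by (simp add: N_def)
  moreover have "\<forall>k. 0 \<le> X k" by (simp add: X_def)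
  ultimately obtain L where L: "X \<longlonglongrightarrow> L" by (rule decseq_convergent)
  have dens: "max_rainbow_density (complete_graph t) (k + N) r = X k" for k
  proof -
    have "r + 1 \<le> k + N" by (simp add: N_def)
    then have "r \<le> (k + N) choose 2"
    proof -
      have "r * 2 \<le> (r + 1) * r" using r by (cases r) auto
      also have "\<dots> \<le> (k + N) * (k + N - 1)"
        using \<open>r + 1 \<le> k + N\<close> by (intro mult_le_mono) auto
      finally show ?thesis by (simp add: choose_two less_eq_div_iff_mult_less_eq)
    qed
    then show ?thesis
      using max_rainbow_copies_complete_graph[OF r, of "k + N" t]
      by (simp add: max_rainbow_density_def card_copies_complete_graph X_def)
  qed
  have "(\<lambda>k. max_rainbow_density (complete_graph t) (k + N) r) \<longlonglongrightarrow> L"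
    using L by (simp add: dens)
  then have "(\<lambda>n. max_rainbow_density (complete_graph t) n r) \<longlonglongrightarrow> L"
    by (rule LIMSEQ_offset)
  then have "limit_rainbow_density (complete_graph t) r = L"
    by (simp add: limit_rainbow_density_def limI)
  moreover have "p \<le> X k" for k
    using lb[of "k + N"] by (simp add: X_def N_def field_simps)
  then have "p \<le> L"
    using L by (auto intro: LIMSEQ_le_const)
  ultimately show ?thesis by simp
qed

section \<open>Tilted random colorings\<close>

definition tilt :: "nat \<Rightarrow> real" where
  "tilt k = (if k = 1 then 2 else if k = 2 \<or> k = 3 then -1 else 0)"

lemma abs_tilt_le: "\<bar>tilt k\<bar> \<le> 2"
  by (simp add: tilt_def)

text \<open>This keeps the tilted color weights of an edge summing to 1; \<open>r \<ge> 3\<close>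
  puts all three tilted colors in range.\<close>

lemma sum_tilt:
  assumes "r \<ge> 3"
  shows "(\<Sum>k\<in>{1..r}. tilt k) = 0"
proof -
  have "(\<Sum>k\<in>{1..r}. tilt k) = (\<Sum>k\<in>{1, 2, 3}. tilt k)"
    by (rule sum.mono_neutral_right) (use assms in \<open>auto simp: tilt_def\<close>)
  then show ?thesis by (simp add: tilt_def)
qed

text \<open>Any other 3-set contains a color of tilt 0. Hence no injectively colored triple of edges
  contributes negatively.\<close>

lemma prod_tilt_card_3:
  assumes "card K = 3"
  shows "(\<Prod>k\<in>K. tilt k) = (if K = {1, 2, 3} then 2 else 0)"
proof (cases "K = {1, 2, 3}")
  case True
  then show ?thesis by (simp add: tilt_def)
next
  case False
  have fin: "finite K" using assms card.infinite by fastforce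
  have "\<not> K \<subseteq> {1, 2, 3}"
    using False assms card_subset_eq[of "{1, 2, 3::nat}" K] by auto
  then obtain k where "k \<in> K" "k \<notin> {1, 2, 3}" by blast
  then have "tilt k = 0" by (simp add: tilt_def)
  then show ?thesis using \<open>k \<in> K\<close> fin False by auto
qed

section \<open>Averages over random vertex signs\<close>

definition signs :: "'a set \<Rightarrow> ('a \<Rightarrow> real) set" where
  "signs V = V \<rightarrow>\<^sub>E {1, -1}"

text \<open>For finite \<open>V\<close>, this is \<open>2 ^ card V\<close> times the expected
  product of the edge signs of \<open>G\<close> under independent fair vertex signs.\<close>

definition sign_sum :: "'a set \<Rightarrow> 'a set set \<Rightarrow> real" where
  "sign_sum V G = (\<Sum>s\<in>signs V. \<Prod>e\<in>G. \<Prod>v\<in>e. s v)"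

lemma finite_signs [simp]: "finite V \<Longrightarrow> finite (signs V)"
  by (simp add: signs_def finite_PiE)

lemma card_signs: "finite V \<Longrightarrow> card (signs V) = 2 ^ card V"
  by (simp add: signs_def card_funcsetE numeral_2_eq_2)

text \<open>Regrouping by vertices gives \<open>s v\<close> to the power of the degree of
  \<open>v\<close> in \<open>G\<close>; the sum over independent signs then factors. Each factor is
  2 for even degree and 0 for odd degree.\<close>

lemma sign_sum_eq_prod:
  assumes V: "finite V" and G: "finite G" "\<And>e. e \<in> G \<Longrightarrow> e \<subseteq> V"
  shows "sign_sum V G = (\<Prod>v\<in>V. 1 + (-1) ^ card {e \<in> G. v \<in> e})"
proof -
  have "(\<Prod>e\<in>G. \<Prod>v\<in>e. s v) = (\<Prod>v\<in>V. s v ^ card {e \<in> G. v \<in> e})" for s :: "'a \<Rightarrow> real"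
  proof -
    have "(\<Prod>e\<in>G. \<Prod>v\<in>e. s v) = (\<Prod>e\<in>G. \<Prod>v\<in>{v \<in> V. v \<in> e}. s v)"
      using G(2) by (intro prod.cong refl) auto
    also have "\<dots> = (\<Prod>v\<in>V. \<Prod>e\<in>{e \<in> G. v \<in> e}. s v)"
      by (rule prod.swap_restrict) (fact V G)+
    finally show ?thesis by simp
  qed
  then have "sign_sum V G = (\<Sum>s\<in>V \<rightarrow>\<^sub>E {1, -1}. \<Prod>v\<in>V. s v ^ card {e \<in> G. v \<in> e})"
    by (simp add: sign_sum_def signs_def)
  also have "\<dots> = (\<Prod>v\<in>V. \<Sum>x\<in>{1, -1}. x ^ card {e \<in> G. v \<in> e})"
    by (subst prod_sum_PiE) (use V in auto)
  finally show ?thesis by simp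
qed

lemma sign_sum_bounds:
  assumes "finite V" "finite G" "\<And>e. e \<in> G \<Longrightarrow> e \<subseteq> V"
  shows "0 \<le> sign_sum V G" "sign_sum V G \<le> 2 ^ card V"
proof -
  have b: "0 \<le> 1 + (-1::real) ^ m \<and> 1 + (-1::real) ^ m \<le> 2" for m
    by (cases "even m") auto
  have eq: "sign_sum V G = (\<Prod>v\<in>V. 1 + (-1) ^ card {e \<in> G. v \<in> e})"
    using assms by (rule sign_sum_eq_prod)
  show "0 \<le> sign_sum V G"
    unfolding eq using b by (intro prod_nonneg) auto
  have "(\<Prod>v\<in>V. 1 + (-1::real) ^ card {e \<in> G. v \<in> e}) \<le> (\<Prod>v\<in>V. 2)"
    using b by (intro prod_mono) auto
  then show "sign_sum V G \<le> 2 ^ card V"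
    unfolding eq by simp
qed

lemma sign_sum_empty [simp]: "finite V \<Longrightarrow> sign_sum V {} = 2 ^ card V"
  by (simp add: sign_sum_def card_signs)

text \<open>One edge, or two distinct edges, always leave a vertex of degree 1, whose factor
  vanishes.\<close>

lemma sign_sum_eq_0:
  assumes V: "finite V" and G: "G \<subseteq> pairs V" "card G = 1 \<or> card G = 2"
  shows "sign_sum V G = 0"
proof -
  have "\<exists>v\<in>V. card {e \<in> G. v \<in> e} = 1"
    using G(2)
  proof
    assume "card G = 1"
    then obtain e where e: "G = {e}" by (auto simp: card_1_singleton_iff)
    then have "e \<noteq> {}" "e \<subseteq> V" using G(1) by (auto simp: pairs_def)
    then obtain v where v: "v \<in> e" "v \<in> V" by blast
    then have "{e \<in> G. v \<in> e} = {e}" using e by auto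
    then have "card {e \<in> G. v \<in> e} = 1" by simp
    then show ?thesis using v(2) by blast
  next
    assume "card G = 2"
    then obtain e e' where e: "G = {e, e'}" "e \<noteq> e'" by (auto simp: card_2_iff)
    then have c: "card e = 2" "card e' = 2" "e \<subseteq> V" using G(1) by (auto simp: pairs_def)
    have "\<not> e \<subseteq> e'"
      using c e(2) card_subset_eq[of e' e] card.infinite[of e'] by auto
    then obtain v where v: "v \<in> e" "v \<notin> e'" by blast
    then have "{e \<in> G. v \<in> e} = {e}" using e by auto
    then have "card {e \<in> G. v \<in> e} = 1" by simp
    moreover have "v \<in> V" using v c by blast
    ultimately show ?thesis by blast
  qed
  then obtain v where v: "v \<in> V" "card {e \<in> G. v \<in> e} = 1" by blast
  then have "(\<Prod>v\<in>V. 1 + (-1::real) ^ card {e \<in> G. v \<in> e}) = 0"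
    using V by (intro prod_zero bexI[of _ v]) auto
  moreover have "finite G" using G(1) finite_pairs[OF V] by (rule finite_subset)
  ultimately show ?thesis
    using G(1) by (subst sign_sum_eq_prod[OF V]) (auto simp: pairs_def)
qed

text \<open>All degrees are 2 on \<open>T\<close> and 0 elsewhere, so every factor is 2.\<close>

lemma sign_sum_triangle:
  assumes V: "finite V" and T: "T \<subseteq> V" "card T = 3"
  shows "sign_sum V (pairs T) = 2 ^ card V"
proof -
  have fin: "finite T" using V T(1) finite_subset by blast
  have "even (card {e \<in> pairs T. v \<in> e})" for v
  proof (cases "v \<in> T")
    case True
    have "bij_betw (\<lambda>w. {v, w}) (T - {v}) {e \<in> pairs T. v \<in> e}"
      using True by (auto simp: bij_betw_def inj_on_def pairs_def card_2_iff doubleton_eq_iff image_iff)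
    then have "card {e \<in> pairs T. v \<in> e} = card (T - {v})"
      by (simp add: bij_betw_same_card)
    then show ?thesis using T True fin by simp
  next
    case False
    then have "{e \<in> pairs T. v \<in> e} = {}" by (auto simp: pairs_def)
    then show ?thesis by (simp only: card.empty even_zero)
  qed
  then have "(\<Prod>v\<in>V. 1 + (-1::real) ^ card {e \<in> pairs T. v \<in> e}) = 2 ^ card V"
    by simp
  then show ?thesis
    using V fin T by (subst sign_sum_eq_prod) (auto simp: pairs_def)
qed

section \<open>Injective colorings and product measures\<close>

definition inj_colorings :: "nat \<Rightarrow> 'a set \<Rightarrow> ('a \<Rightarrow> nat) set" where
  "inj_colorings r F = {d \<in> F \<rightarrow>\<^sub>E {1..r}. inj_on d F}"

lemma finite_inj_colorings [simp]: "finite F \<Longrightarrow> finite (inj_colorings r F)"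
  by (simp add: inj_colorings_def finite_PiE)

lemma card_inj_colorings:
  assumes "finite F" "card F \<le> r"
  shows "real (card (inj_colorings r F)) = real (r choose card F) * fact (card F)"
proof -
  have "card (inj_colorings r F) = (\<Prod>i = 0..<card F. r - i)"
    using card_inj_on_subset_funcset[OF assms(1), of "{1..r}" F] by (simp add: inj_colorings_def)
  also have "real \<dots> = (\<Prod>i = 0..<card F. real r - real i)"
    unfolding of_nat_prod using assms(2) by (intro prod.cong refl) (auto simp: of_nat_diff)
  also have "\<dots> = real (r choose card F) * fact (card F)"
    by (simp add: gbinomial_mult_fact' binomial_gbinomial)
  finally show ?thesis .
qed

text \<open>Sums out the colors of the edges outside \<open>F\<close> in a product measure.\<close>

lemma sum_weights_inj_on:
  fixes w :: "'a \<Rightarrow> nat \<Rightarrow> real"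
  assumes E: "finite E" "F \<subseteq> E" and w: "\<And>e. e \<in> E \<Longrightarrow> (\<Sum>k\<in>{1..r}. w e k) = 1"
  shows "(\<Sum>c\<in>E \<rightarrow>\<^sub>E {1..r}. (\<Prod>e\<in>E. w e (c e)) * of_bool (inj_on c F))
       = (\<Sum>d\<in>inj_colorings r F. \<Prod>e\<in>F. w e (d e))"
proof -
  have fin: "finite (inj_colorings r F)" "finite F"
    using E finite_subset[OF E(2,1)] by auto
  \<comment> \<open>Multiplying over \<open>E\<close> yields the weight of \<open>c\<close> times
    the indicator that \<open>c\<close> agrees with \<open>d\<close> on \<open>F\<close>. At most
    one injective \<open>d\<close> matches, and one does exactly when \<open>c\<close> is injective
    on \<open>F\<close>. Being a product over edges, the sum over \<open>c\<close> factors.\<close>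
  let ?u = "\<lambda>d e k. w e k * (if e \<in> F then of_bool (k = d e) else 1)"
  have "(\<Prod>e\<in>E. w e (c e)) * of_bool (inj_on c F) = (\<Sum>d\<in>inj_colorings r F. \<Prod>e\<in>E. ?u d e (c e))"
    if c: "c \<in> E \<rightarrow>\<^sub>E {1..r}" for c
  proof -
    have ind: "(\<Prod>e\<in>E. if e \<in> F then of_bool (c e = d e) else (1::real)) = of_bool (d = restrict c F)"
      if "d \<in> inj_colorings r F" for d
    proof (cases "d = restrict c F")
      case True
      then show ?thesis by (auto intro: prod.neutral)
    next
      case False
      have "d \<in> extensional F" using that by (auto simp: inj_colorings_def PiE_def)
      then obtain e where "e \<in> F" "c e \<noteq> d e"
        using False extensionalityI[of d F "restrict c F"] by fastforce
      then show ?thesis using False E by auto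
    qed
    have mem: "restrict c F \<in> inj_colorings r F \<longleftrightarrow> inj_on c F"
      using c E(2) by (auto simp: inj_colorings_def)
    have "(\<Sum>d\<in>inj_colorings r F. \<Prod>e\<in>E. ?u d e (c e))
        = (\<Prod>e\<in>E. w e (c e)) * (\<Sum>d\<in>inj_colorings r F. of_bool (d = restrict c F))"
      unfolding prod.distrib sum_distrib_left[symmetric] by (simp add: ind)
    also have "(\<Sum>d\<in>inj_colorings r F. of_bool (d = restrict c F)) = (of_bool (inj_on c F) :: real)"
      using fin mem by (simp add: of_bool_def)
    finally show ?thesis by simp
  qed
  then have "(\<Sum>c\<in>E \<rightarrow>\<^sub>E {1..r}. (\<Prod>e\<in>E. w e (c e)) * of_bool (inj_on c F))
      = (\<Sum>c\<in>E \<rightarrow>\<^sub>E {1..r}. \<Sum>d\<in>inj_colorings r F. \<Prod>e\<in>E. ?u d e (c e))"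
    by (intro sum.cong) auto
  also have "\<dots> = (\<Sum>d\<in>inj_colorings r F. \<Sum>c\<in>E \<rightarrow>\<^sub>E {1..r}. \<Prod>e\<in>E. ?u d e (c e))"
    by (rule sum.swap)
  also have "\<dots> = (\<Sum>d\<in>inj_colorings r F. \<Prod>e\<in>E. \<Sum>k\<in>{1..r}. ?u d e k)"
    using E by (subst prod_sum_PiE) auto
  also have "\<dots> = (\<Sum>d\<in>inj_colorings r F. \<Prod>e\<in>F. w e (d e))"
  proof (intro sum.cong refl)
    fix d assume d: "d \<in> inj_colorings r F"
    have "(\<Sum>k\<in>{1..r}. ?u d e k) = (if e \<in> F then w e (d e) else 1)" if "e \<in> E" for e
    proof (cases "e \<in> F")
      case True
      then have "d e \<in> {1..r}" using d by (auto simp: inj_colorings_def)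
      have "(\<Sum>k\<in>{1..r}. ?u d e k) = (\<Sum>k\<in>{1..r}. if k = d e then w e k else 0)"
        using True by (intro sum.cong) auto
      then show ?thesis using True \<open>d e \<in> {1..r}\<close> by simp
    next
      case False
      then show ?thesis using w[OF that] by simp
    qed
    then have "(\<Prod>e\<in>E. \<Sum>k\<in>{1..r}. ?u d e k) = (\<Prod>e\<in>E. if e \<in> F then w e (d e) else 1)"
      by (intro prod.cong) auto
    also have "\<dots> = (\<Prod>e\<in>F. w e (d e))"
      using E by (simp add: prod.If_cases Int_absorb1)
    finally show "(\<Prod>e\<in>E. \<Sum>k\<in>{1..r}. ?u d e k) = (\<Prod>e\<in>F. w e (d e))" .
  qed
  finally show ?thesis .
qed

text \<open>Up to the factor \<open>2 ^ card V\<close>, the probability that \<open>F\<close> is rainbow when the vertices receive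
  independent fair signs \<open>s\<close> and then each edge \<open>e\<close> independently receives color \<open>k\<close> with probability
  \<open>1 / r + \<epsilon> * tilt k * (\<Prod>v\<in>e. s v)\<close>.\<close>

definition rainbow_weight :: "nat \<Rightarrow> real \<Rightarrow> 'a set \<Rightarrow> 'a set set \<Rightarrow> real" where
  "rainbow_weight r \<epsilon> V F =
     (\<Sum>s\<in>signs V. \<Sum>d\<in>inj_colorings r F. \<Prod>e\<in>F. \<epsilon> * tilt (d e) * (\<Prod>v\<in>e. s v) + 1 / real r)"

text \<open>The left side is \<open>2 ^ n\<close> times the expected number of rainbow
  \<open>t\<close>-sets in the random coloring, and an expectation cannot exceed the
  maximum.\<close>

lemma sum_rainbow_weight_le:
  fixes r t n :: nat and \<epsilon> :: real
  assumes r: "r \<ge> 3" and \<epsilon>: "0 \<le> \<epsilon>" "\<epsilon> \<le> 1 / (2 * real r)"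
  shows "(\<Sum>S | S \<subseteq> {1..n} \<and> card S = t. rainbow_weight r \<epsilon> {1..n} (pairs S))
       \<le> 2 ^ n * real (max_rainbow_sets t r n)"
proof -
  let ?V = "{1..n}" and ?C = "pairs {1..n} \<rightarrow>\<^sub>E {1..r}"
  let ?\<S> = "{S. S \<subseteq> {1..n} \<and> card S = t}"
  define w where "w = (\<lambda>(s :: nat \<Rightarrow> real) e k. \<epsilon> * tilt k * (\<Prod>v\<in>e. s v) + 1 / real r)"
  define W where "W = (\<lambda>s c. \<Prod>e\<in>pairs ?V. w s e (c e))"
  have w1: "(\<Sum>k\<in>{1..r}. w s e k) = 1" for s :: "nat \<Rightarrow> real" and e
    using sum_tilt[OF r] r
    by (simp add: w_def sum.distrib flip: sum_distrib_left sum_distrib_right)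
  have w0: "0 \<le> w s e k" if s: "s \<in> signs ?V" and e: "e \<in> pairs ?V" for s e k
  proof -
    have "\<bar>\<Prod>v\<in>e. s v\<bar> = (\<Prod>v\<in>e. \<bar>s v\<bar>)" by (rule abs_prod)
    also have "\<dots> = 1"
    proof (intro prod.neutral ballI)
      fix v assume "v \<in> e"
      then have "v \<in> ?V" using e by (auto simp: pairs_def)
      then have "s v \<in> {1, -1}" using s by (auto simp: signs_def PiE_mem)
      then show "\<bar>s v\<bar> = 1" by auto
    qed
    finally have "\<bar>\<epsilon> * tilt k * (\<Prod>v\<in>e. s v)\<bar> = \<epsilon> * \<bar>tilt k\<bar>"
      using \<epsilon>(1) by (simp add: abs_mult)
    \<comment> \<open>Since \<open>abs_tilt_le\<close> gives 2, the perturbation is at most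
      \<open>1 / r\<close>, so the weights are genuine probabilities.\<close>
    also have "\<dots> \<le> 1 / (2 * real r) * 2"
      using \<epsilon> abs_tilt_le by (intro mult_mono) auto
    finally show ?thesis by (simp add: w_def)
  qed
  have W0: "0 \<le> W s c" if "s \<in> signs ?V" for s c
    unfolding W_def using w0[OF that] by (intro prod_nonneg) auto
  have W1: "(\<Sum>c\<in>?C. W s c) = 1" for s
  proof -
    have "(\<Sum>c\<in>?C. W s c) = (\<Prod>e\<in>pairs ?V. \<Sum>k\<in>{1..r}. w s e k)"
      unfolding W_def by (rule prod_sum_PiE[symmetric]) simp_all
    then show ?thesis unfolding w1 by simp
  qed
  have "(\<Sum>S\<in>?\<S>. rainbow_weight r \<epsilon> ?V (pairs S))
      = (\<Sum>S\<in>?\<S>. \<Sum>s\<in>signs ?V. \<Sum>c\<in>?C. W s c * of_bool (inj_on c (pairs S)))"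
    unfolding rainbow_weight_def
  proof (rule sum.cong[OF refl], rule sum.cong[OF refl])
    fix S and s :: "nat \<Rightarrow> real" assume "S \<in> ?\<S>"
    then have "pairs S \<subseteq> pairs ?V" by (simp add: pairs_mono)
    then show "(\<Sum>d\<in>inj_colorings r (pairs S). \<Prod>e\<in>pairs S. \<epsilon> * tilt (d e) * (\<Prod>v\<in>e. s v) + 1 / real r)
        = (\<Sum>c\<in>?C. W s c * of_bool (inj_on c (pairs S)))"
      unfolding W_def by (subst sum_weights_inj_on[OF _ _ w1]) (simp_all add: w_def)
  qed
  also have "\<dots> = (\<Sum>s\<in>signs ?V. \<Sum>S\<in>?\<S>. \<Sum>c\<in>?C. W s c * of_bool (inj_on c (pairs S)))"
    by (rule sum.swap)
  also have "\<dots> = (\<Sum>s\<in>signs ?V. \<Sum>c\<in>?C. \<Sum>S\<in>?\<S>. W s c * of_bool (inj_on c (pairs S)))"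
    by (intro sum.cong refl) (rule sum.swap)
  also have "\<dots> = (\<Sum>s\<in>signs ?V. \<Sum>c\<in>?C. W s c * real (card (rainbow_sets t ?V c)))"
  proof (intro sum.cong refl)
    fix s :: "nat \<Rightarrow> real" and c
    have "?\<S> \<inter> {S. inj_on c (pairs S)} = rainbow_sets t ?V c"
      by (auto simp: rainbow_sets_def)
    then show "(\<Sum>S\<in>?\<S>. W s c * of_bool (inj_on c (pairs S))) = W s c * real (card (rainbow_sets t ?V c))"
      by (simp add: sum.If_cases flip: sum_distrib_left)
  qed
  also have "\<dots> \<le> (\<Sum>s\<in>signs ?V. \<Sum>c\<in>?C. W s c * real (max_rainbow_sets t r n))"
  proof (intro sum_mono mult_left_mono W0)
    fix c assume "c \<in> ?C"
    then have "c ` pairs ?V \<subseteq> {1..r}" by auto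
    then show "real (card (rainbow_sets t ?V c)) \<le> real (max_rainbow_sets t r n)"
      using card_rainbow_sets_le_max[of ?V n c r t] by simp
  qed
  also have "\<dots> = 2 ^ n * real (max_rainbow_sets t r n)"
    unfolding sum_distrib_right[symmetric] W1 by (simp add: card_signs)
  finally show ?thesis .
qed

section \<open>Expansion over sets of tilted edges\<close>

definition tilt_sum :: "nat \<Rightarrow> 'a set \<Rightarrow> 'a set \<Rightarrow> real" where
  "tilt_sum r F G = (\<Sum>d\<in>inj_colorings r F. \<Prod>e\<in>G. tilt (d e))"

text \<open>\<open>G\<close> collects the edges for which the tilt term is chosen in the product,
  the others giving \<open>1 / r\<close>. Signs and colors then occur in separate factors, so their
  sums split.\<close>

lemma rainbow_weight_expansion:
  assumes "finite F"
  shows "rainbow_weight r \<epsilon> V F =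
    (\<Sum>G\<in>Pow F. \<epsilon> ^ card G * (1 / real r) ^ card (F - G) * tilt_sum r F G * sign_sum V G)"
proof -
  let ?D = "inj_colorings r F"
  have "rainbow_weight r \<epsilon> V F = (\<Sum>s\<in>signs V. \<Sum>d\<in>?D. \<Sum>G\<in>Pow F.
      (\<epsilon> ^ card G * (1 / real r) ^ card (F - G)) * (\<Prod>e\<in>G. tilt (d e)) * (\<Prod>e\<in>G. \<Prod>v\<in>e. s v))"
    unfolding rainbow_weight_def
    by (simp add: prod_add[OF assms] prod.distrib mult_ac)
  also have "\<dots> = (\<Sum>G\<in>Pow F. \<Sum>s\<in>signs V. \<Sum>d\<in>?D.
      (\<epsilon> ^ card G * (1 / real r) ^ card (F - G)) * (\<Prod>e\<in>G. tilt (d e)) * (\<Prod>e\<in>G. \<Prod>v\<in>e. s v))"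
    by (subst sum.swap, subst sum.swap[of _ "Pow F"]) (intro sum.cong refl sum.swap)
  also have "\<dots> = (\<Sum>G\<in>Pow F. (\<epsilon> ^ card G * (1 / real r) ^ card (F - G)) * tilt_sum r F G * sign_sum V G)"
    unfolding tilt_sum_def sign_sum_def
    by (simp only: sum_distrib_left[symmetric] sum_distrib_right[symmetric] mult.assoc)
  finally show ?thesis by (simp add: mult_ac)
qed

lemma tilt_sum_empty: "tilt_sum r F {} = real (card (inj_colorings r F))"
  by (simp add: tilt_sum_def)

lemma abs_tilt_sum_le:
  assumes "finite F" "G \<subseteq> F"
  shows "\<bar>tilt_sum r F G\<bar> \<le> real r ^ card F * 2 ^ card F"
proof -
  have "\<bar>tilt_sum r F G\<bar> \<le> (\<Sum>d\<in>inj_colorings r F. 2 ^ card F)"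
    unfolding tilt_sum_def
  proof (rule order.trans[OF sum_abs], rule sum_mono)
    fix d
    have "\<bar>\<Prod>e\<in>G. tilt (d e)\<bar> \<le> (\<Prod>e\<in>G. 2)"
      unfolding abs_prod using abs_tilt_le by (intro prod_mono) auto
    also have "\<dots> \<le> 2 ^ card F"
      using assms by (simp add: card_mono)
    finally show "\<bar>\<Prod>e\<in>G. tilt (d e)\<bar> \<le> 2 ^ card F" .
  qed
  also have "\<dots> = real (card (inj_colorings r F)) * 2 ^ card F" by simp
  also have "\<dots> \<le> real r ^ card F * 2 ^ card F"
  proof -
    have "card (inj_colorings r F) \<le> card (F \<rightarrow>\<^sub>E {1..r})"
      using assms(1) by (intro card_mono finite_PiE) (auto simp: inj_colorings_def)
    also have "\<dots> = r ^ card F" using assms(1) by (simp add: card_funcsetE)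
    finally have "real (card (inj_colorings r F)) \<le> real r ^ card F"
      by (metis of_nat_le_iff of_nat_power)
    then show ?thesis by (intro mult_right_mono) auto
  qed
  finally show ?thesis .
qed

text \<open>By \<open>prod_tilt_card_3\<close> each summand is 2 or 0, so a single injective
  coloring of \<open>F\<close> sending \<open>G\<close> onto \<open>{1, 2, 3}\<close>
  suffices.\<close>

lemma tilt_sum_card_3:
  assumes F: "finite F" "G \<subseteq> F" and G: "card G = 3" and r: "card F \<le> r"
  shows "2 \<le> tilt_sum r F G"
proof -
  have prod: "(\<Prod>e\<in>G. tilt (d e)) = (if d ` G = {1, 2, 3} then 2 else 0)"
    if "d \<in> inj_colorings r F" for d
  proof -
    have inj: "inj_on d G" using that F(2) by (auto simp: inj_colorings_def intro: inj_on_subset)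
    then have "(\<Prod>e\<in>G. tilt (d e)) = (\<Prod>k\<in>d ` G. tilt k)" by (simp add: prod.reindex)
    then show ?thesis using prod_tilt_card_3[of "d ` G"] inj G by (simp add: card_image)
  qed
  have fin: "finite G" "finite (F - G)" using F finite_subset by auto
  have "3 \<le> r" using G r card_mono[OF F] by simp
  obtain g where g: "bij_betw g G {1, 2, 3::nat}"
    using finite_same_card_bij[of G "{1, 2, 3::nat}"] fin G by auto
  have "card (F - G) = card F - 3" using F G by (simp add: card_Diff_subset finite_subset)
  \<comment> \<open>The bound \<open>card F \<le> r\<close> leaves enough further colors to color
    the remaining edges injectively.\<close>
  then have "card (F - G) \<le> card ({1..r} - {1, 2, 3})"
    using r \<open>3 \<le> r\<close> by (subst card_Diff_subset) auto
  then obtain h where h: "inj_on h (F - G)" "h ` (F - G) \<subseteq> {1..r} - {1, 2, 3}"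
    using card_le_inj[of "F - G" "{1..r} - {1, 2, 3}"] fin by auto
  define d where "d = restrict (\<lambda>e. if e \<in> G then g e else h e) F"
  have dg: "d e = g e" if "e \<in> G" for e using that F by (auto simp: d_def)
  have dh: "d e = h e" if "e \<in> F - G" for e using that by (auto simp: d_def)
  have img: "d ` G = {1, 2, 3}" "d ` (F - G) = h ` (F - G)"
    using g dg dh by (auto simp: bij_betw_def)
  have "inj_on d (G \<union> (F - G))"
    unfolding inj_on_Un
  proof (intro conjI)
    show "inj_on d G" using g dg by (simp add: bij_betw_def cong: inj_on_cong)
    show "inj_on d (F - G)" using h(1) inj_on_cong[of "F - G" d h, OF dh] by simp
    show "d ` (G - (F - G)) \<inter> d ` (F - G - G) = {}"
    proof -
      have "G - (F - G) = G" "F - G - G = F - G" by auto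
      then show ?thesis using img h(2) by auto
    qed
  qed
  moreover have "G \<union> (F - G) = F" using F by auto
  moreover have "d ` F \<subseteq> {1..r}"
  proof -
    have "d ` F = d ` G \<union> d ` (F - G)" using F by auto
    then show ?thesis using img h(2) \<open>3 \<le> r\<close> by auto
  qed
  moreover have "d \<in> extensional F" by (simp add: d_def)
  ultimately have d: "d \<in> inj_colorings r F"
    by (auto simp: inj_colorings_def PiE_def)
  have "2 = (\<Prod>e\<in>G. tilt (d e))" using prod[OF d] img by simp
  also have "\<dots> \<le> tilt_sum r F G"
    unfolding tilt_sum_def
    by (rule member_le_sum[OF d]) (use prod F in \<open>auto simp: split: if_splits\<close>)
  finally show ?thesis .
qed

section \<open>The triangle terms dominate\<close>

text \<open>The empty set gives the uniform value, and one triangle gives the cubic gain. Other sets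
  of three edges are nonnegative, so only sets of at least four edges can cause loss.\<close>

lemma rainbow_weight_ge:
  fixes V S :: "'a set" and \<epsilon> :: real
  assumes V: "finite V" "S \<subseteq> V" and S: "3 \<le> card S" and r: "card S choose 2 \<le> r"
    and \<epsilon>: "0 \<le> \<epsilon>" "\<epsilon> \<le> 1"
  defines "m \<equiv> card S choose 2"
  shows "2 ^ card V * (real (r choose m) * fact m / real r ^ m + (2 * \<epsilon> ^ 3 / real r ^ m - \<epsilon> ^ 4 * (4 * real r) ^ m))
       \<le> rainbow_weight r \<epsilon> V (pairs S)"
proof -
  let ?F = "pairs S"
  have fin: "finite S" "finite ?F" using finite_subset[OF V(2,1)] by auto
  have m: "card ?F = m" unfolding m_def by (rule card_pairs) (rule fin)
  have mr: "m \<le> r" using r by (simp add: m_def)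
  obtain T where T: "T \<subseteq> S" "card T = 3"
    using obtain_subset_with_card_n[OF S] by blast
  have cardT: "card (pairs T) = 3"
    using T finite_subset[OF T(1) fin(1)] by (simp add: card_pairs choose_two)
  have TF: "pairs T \<subseteq> ?F" using T(1) by (rule pairs_mono)
  have "3 \<le> m" using card_mono[OF fin(2) TF] cardT m by simp
  then have r1: "1 \<le> real r" using mr by simp
  have FV: "?F \<subseteq> pairs V" using V(2) by (rule pairs_mono)
  define summand where "summand = (\<lambda>G. \<epsilon> ^ card G * (1 / real r) ^ card (?F - G) * tilt_sum r ?F G * sign_sum V G)"
  \<comment> \<open>Bounds the loss from one set of at least four edges:
    \<open>\<epsilon> \<le> 1\<close> caps its power at \<open>\<epsilon> ^ 4\<close>, powers of
    \<open>1 / r\<close> are at most 1, and the tilt and sign sums are bounded crudely.\<close>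
  let ?b = "\<epsilon> ^ 4 * (2 * real r) ^ m * 2 ^ card V"
  have inv1: "0 \<le> (1 / real r) ^ k" "(1 / real r) ^ k \<le> 1" for k
    using r1 by (auto intro: power_le_one)
  have ss: "0 \<le> sign_sum V G" "sign_sum V G \<le> 2 ^ card V" if "G \<subseteq> ?F" for G
  proof -
    have "finite G" using fin(2) that finite_subset by blast
    moreover have "e \<subseteq> V" if "e \<in> G" for e
    proof -
      have "e \<in> pairs V" using that \<open>G \<subseteq> ?F\<close> FV by blast
      then show ?thesis by (simp add: pairs_def)
    qed
    ultimately show "0 \<le> sign_sum V G" "sign_sum V G \<le> 2 ^ card V"
      using sign_sum_bounds[of V G] V(1) by auto
  qed
  have empty: "summand {} = 2 ^ card V * (real (r choose m) * fact m / real r ^ m)"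
    using V(1) card_inj_colorings[OF fin(2)] m mr
    by (simp add: summand_def tilt_sum_empty power_one_over)
  have triangle: "2 ^ card V * (2 * \<epsilon> ^ 3 / real r ^ m) \<le> summand (pairs T)"
  proof -
    have "2 ^ card V * (2 * \<epsilon> ^ 3 / real r ^ m) = \<epsilon> ^ 3 * (1 / real r) ^ m * 2 * 2 ^ card V"
      by (simp add: power_one_over field_simps)
    also have "\<dots> \<le> \<epsilon> ^ 3 * (1 / real r) ^ card (?F - pairs T) * tilt_sum r ?F (pairs T) * 2 ^ card V"
    proof (intro mult_right_mono mult_mono mult_left_mono)
      show "(1 / real r) ^ m \<le> (1 / real r) ^ card (?F - pairs T)"
        using r1 m card_mono[OF fin(2), of "?F - pairs T"] by (intro power_decreasing) auto
      show "2 \<le> tilt_sum r ?F (pairs T)"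
        by (rule tilt_sum_card_3) (use fin TF cardT m mr in auto)
    qed (use \<epsilon> inv1 in auto)
    also have "\<dots> = summand (pairs T)"
      using sign_sum_triangle[OF V(1), of T] T V(2) cardT by (simp add: summand_def)
    finally show ?thesis .
  qed
  have rest: "- ?b \<le> summand G" if G: "G \<subseteq> ?F" "G \<noteq> {}" for G
  proof -
    have finG: "finite G" using fin(2) G(1) finite_subset by blast
    have b0: "0 \<le> ?b" using \<epsilon> by simp
    have "card G \<noteq> 0" using finG G(2) by simp
    then consider "card G = 1 \<or> card G = 2" | "card G = 3" | "4 \<le> card G" by linarith
    then show ?thesis
    proof cases
      case 1
      then have "sign_sum V G = 0" using sign_sum_eq_0[OF V(1)] G(1) FV by blast
      then show ?thesis using b0 by (simp add: summand_def)
    next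
      case 2
      then have "2 \<le> tilt_sum r ?F G"
        using tilt_sum_card_3[OF fin(2) G(1)] m mr by simp
      then have "0 \<le> summand G"
        unfolding summand_def using \<epsilon> inv1 ss[OF G(1)] by (intro mult_nonneg_nonneg) auto
      then show ?thesis using b0 by linarith
    next
      case 3
      have "\<bar>summand G\<bar> = \<epsilon> ^ card G * (1 / real r) ^ card (?F - G) * \<bar>tilt_sum r ?F G\<bar> * sign_sum V G"
        using \<epsilon> ss[OF G(1)] by (simp add: summand_def abs_mult)
      also have "\<dots> \<le> \<epsilon> ^ 4 * 1 * (real r ^ m * 2 ^ m) * 2 ^ card V"
      proof (intro mult_mono)
        show "\<epsilon> ^ card G \<le> \<epsilon> ^ 4" using \<epsilon> 3 by (intro power_decreasing) auto
        show "\<bar>tilt_sum r ?F G\<bar> \<le> real r ^ m * 2 ^ m"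
          using abs_tilt_sum_le[OF fin(2) G(1)] m by simp
      qed (use \<epsilon> inv1 ss[OF G(1)] in auto)
      also have "\<dots> = ?b" by (simp add: power_mult_distrib)
      finally show ?thesis by linarith
    qed
  qed
  let ?R = "Pow ?F - {{}} - {pairs T}"
  have "pairs T \<noteq> {}" using cardT by auto
  have "rainbow_weight r \<epsilon> V ?F = (\<Sum>G\<in>Pow ?F. summand G)"
    unfolding summand_def by (rule rainbow_weight_expansion) (rule fin)
  also have "\<dots> = summand {} + (\<Sum>G\<in>Pow ?F - {{}}. summand G)"
    by (rule sum.remove) (use fin in auto)
  also have "(\<Sum>G\<in>Pow ?F - {{}}. summand G) = summand (pairs T) + (\<Sum>G\<in>?R. summand G)"
    by (rule sum.remove) (use fin TF \<open>pairs T \<noteq> {}\<close> in auto)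
  finally have split: "rainbow_weight r \<epsilon> V ?F = summand {} + (summand (pairs T) + (\<Sum>G\<in>?R. summand G))" .
  \<comment> \<open>There are at most \<open>2 ^ m\<close> sets \<open>G\<close>; this factor turns
    \<open>2 * r\<close> into \<open>4 * r\<close>. As \<open>- ?b\<close> is not positive,
    overcounting the sets only weakens the lower bound.\<close>
  have "(4 * real r) ^ m = 2 ^ m * (2 * real r) ^ m"
    using power_mult_distrib[of 2 "2 * real r" m] by simp
  then have "- (2 ^ card V * (\<epsilon> ^ 4 * (4 * real r) ^ m)) = 2 ^ m * - ?b"
    by simp
  also have "\<dots> \<le> real (card ?R) * - ?b"
  proof (rule mult_right_mono_neg)
    have "card ?R \<le> card (Pow ?F)" using fin by (intro card_mono) auto
    also have "\<dots> = 2 ^ m" using fin m by (simp add: card_Pow)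
    finally show "real (card ?R) \<le> 2 ^ m" by (metis of_nat_le_iff of_nat_numeral of_nat_power)
  qed (use \<epsilon> in simp)
  also have "\<dots> = (\<Sum>G\<in>?R. - ?b)" by simp
  also have "\<dots> \<le> (\<Sum>G\<in>?R. summand G)" by (intro sum_mono rest) auto
  finally show ?thesis
    using empty triangle split by (simp add: distrib_left right_diff_distrib)
qed

lemma complete_graph_rainbow_uncommon:
  fixes t r :: nat
  assumes t: "t \<ge> 3" and r: "r \<ge> t choose 2"
  shows "rainbow_uncommon r (complete_graph t)"
proof -
  define m where "m = t choose 2"
  have "3 choose 2 \<le> t choose 2" using t by (rule binomial_right_mono)
  then have m: "3 \<le> m" by (simp add: m_def choose_two)
  then have r3: "3 \<le> r" using r by (simp add: m_def)
  \<comment> \<open>Chosen so that \<open>\<epsilon> * (4 * r) ^ m = 1 / r ^ m\<close>: the error is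
    then exactly half the triangle gain, leaving
    \<open>\<delta> = \<epsilon> ^ 3 / r ^ m\<close>.\<close>
  define \<epsilon> where "\<epsilon> = 1 / (4 * real r ^ 2) ^ m"
  have \<epsilon>: "0 < \<epsilon>" "\<epsilon> \<le> 1 / (2 * real r)"
  proof -
    show "0 < \<epsilon>" using r3 by (simp add: \<epsilon>_def)
    have "2 * real r \<le> 4 * real r ^ 2" using r3 by (simp add: power2_eq_square)
    also have "\<dots> = (4 * real r ^ 2) ^ 1" by simp
    also have "\<dots> \<le> (4 * real r ^ 2) ^ m"
    proof (rule power_increasing)
      show "1 \<le> 4 * real r ^ 2" using r3 \<open>2 * real r \<le> 4 * real r ^ 2\<close> by linarith
    qed (use m in simp)
    finally show "\<epsilon> \<le> 1 / (2 * real r)"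
      unfolding \<epsilon>_def using r3 by (intro divide_left_mono) auto
  qed
  have "1 / (2 * real r) \<le> 1" using r3 by simp
  then have \<epsilon>1: "\<epsilon> \<le> 1" using \<epsilon> by linarith
  define q where "q = real (r choose m) * fact m / real r ^ m"
  define \<delta> where "\<delta> = 2 * \<epsilon> ^ 3 / real r ^ m - \<epsilon> ^ 4 * (4 * real r) ^ m"
  have "\<epsilon> * (4 * real r) ^ m = 1 / real r ^ m"
    using r3 by (simp add: \<epsilon>_def power_mult_distrib power2_eq_square field_simps)
  then have "\<epsilon> ^ 4 * (4 * real r) ^ m = \<epsilon> ^ 3 / real r ^ m"
    by (simp add: power_Suc[of \<epsilon> 3, simplified] mult.assoc numeral_eq_Suc)
  then have "\<delta> = \<epsilon> ^ 3 / real r ^ m" by (simp add: \<delta>_def)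
  then have "0 < \<delta>" using \<epsilon> r3 by simp
  \<comment> \<open>The gain \<open>\<delta>\<close> does not depend on \<open>n\<close>, so the
    strict improvement survives in the limit.\<close>
  have "q + \<delta> \<le> limit_rainbow_density (complete_graph t) r"
  proof (rule limit_rainbow_density_ge)
    fix n :: nat
    let ?\<S> = "{S. S \<subseteq> {1..n} \<and> card S = t}"
    have "2 ^ n * (real (n choose t) * (q + \<delta>)) = (\<Sum>S\<in>?\<S>. 2 ^ n * (q + \<delta>))"
      by (simp add: n_subsets)
    also have "\<dots> \<le> (\<Sum>S\<in>?\<S>. rainbow_weight r \<epsilon> {1..n} (pairs S))"
    proof (rule sum_mono)
      fix S assume "S \<in> ?\<S>"
      then show "2 ^ n * (q + \<delta>) \<le> rainbow_weight r \<epsilon> {1..n} (pairs S)"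
        using rainbow_weight_ge[of "{1..n}" S r \<epsilon>] t r \<epsilon> \<epsilon>1 by (simp add: q_def \<delta>_def m_def)
    qed
    also have "\<dots> \<le> 2 ^ n * real (max_rainbow_sets t r n)"
      using r3 \<epsilon> by (intro sum_rainbow_weight_le) auto
    finally show "real (n choose t) * (q + \<delta>) \<le> real (max_rainbow_sets t r n)"
      by simp
  qed (use r3 in simp)
  then have "q < limit_rainbow_density (complete_graph t) r" using \<open>0 < \<delta>\<close> by linarith
  moreover have "card (edges (complete_graph t)) = m"
    by (simp add: edges_complete_graph card_pairs m_def)
  ultimately show ?thesis
    by (simp add: rainbow_uncommon_def rainbow_common_def q_def)
qed

theorem theorem2:
  fixes t r :: nat
  assumes "t \<in> {3, 4, 5}"
    and "r \<ge> t choose 2"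
  shows "rainbow_uncommon r (complete_graph t)"
  using assms by (intro complete_graph_rainbow_uncommon) auto

end
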